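(* Let $H$ be a group and $\Omega(H) = \bigl((S,1_S,\ast),\triangleleft,\triangleright,f\bigr)$ an extending datum of $H$. The following statements are equivalent: (1) $H\ltimes S$ is a unified product (i.e. $H \times S$ is a group under the multiplication of $H\ltimes S$); (2) The following compatibilities hold for any $s,s_1,s_2,s_3\in S$ and $h,h_1,h_2\in H$: (ES1) the map $\triangleleft : S\times H\to S$ is a right action of the group $H$ on the set $S$; (ES2) $(s_1\ast s_2)\ast s_3 = \bigl(s_1\triangleleft f(s_2,s_3)\bigr)\ast(s_2\ast s_3)$; (ES3) $s\triangleright(h_1h_2) = (s\triangleright h_1)\bigl((s\triangleleft h_1)\triangleright h_2\bigr)$; (ES4) $(s_1\ast s_2)\triangleleft h = \bigl(s_1\triangleleft(s_2\triangleright h)\bigr)\ast(s_2\triangleleft h)$; (ES5) $\bigl(s_1\triangleright(s_2\triangleright h)\bigr)\, f\bigl(s_1\triangleleft(s_2\triangleright h),\, s_2\triangleleft h\bigr) = f(s_1,s_2)\,\bigl((s_1\ast s_2)\triangleright h\bigr)$; (ES6) $f(s_1,s_2)\,f(s_1\ast s_2,\,s_3) = \bigl(s_1\triangleright f(s_2,s_3)\bigr)\,f\bigl(s_1\triangleleft f(s_2,s_3),\, s_2\ast s_3\bigr)$; (ES7) for any $s\in S$ there exists $s'\in S$ such that $s'\ast s = 1_S$.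
   Context: Let $H$ be a group with unit $1_H$. An extending datum of $H$ is a system $\Omega(H) = \bigl((S,1_S,\ast),\triangleleft,\triangleright,f\bigr)$ where $(S,1_S)$ is a pointed set (a nonempty set $S$ with a fixed element $1_S\in S$), and $\ast : S\times S\to S$, $\triangleleft : S\times H\to S$, $\triangleright : S\times H\to H$, $f : S\times S\to H$ are maps such that for all $s\in S$, $h\in H$: $s\ast 1_S = 1_S\ast s = s$, $s\triangleleft 1_H = s$, $1_S\triangleleft h = 1_S$, $1_S\triangleright h = h$, $s\triangleright 1_H = 1_H$, $f(s,1_S) = f(1_S,s) = 1_H$. For an extending datum $\Omega(H)$, $H\ltimes S = H\ltimes_{\Omega(H)}S$ denotes the set $H\times S$ with the binary operation $$(h_1,s_1)\cdot(h_2,s_2) := \bigl(h_1(s_1\triangleright h_2)f(s_1\triangleleft h_2,s_2),\ (s_1\triangleleft h_2)\ast s_2\bigr).$$ It is called the unified product of $H$ and $\Omega(H)$ if it is a group with this multiplication. *)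

theory Defs
  imports "HOL-Algebra.Group"
begin

locale extending_datum = group H
  for H :: "('a, 'm) monoid_scheme" (structure) +
  fixes S :: "'s set"
    and oneS :: 's
    and star :: "'s \<Rightarrow> 's \<Rightarrow> 's"  (infixl "\<star>" 70)
    and ract :: "'s \<Rightarrow> 'a \<Rightarrow> 's"  (infixl "\<triangleleft>" 75)
    and lact :: "'s \<Rightarrow> 'a \<Rightarrow> 'a"  (infixr "\<triangleright>" 75)
    and f :: "'s \<Rightarrow> 's \<Rightarrow> 'a"
  assumes oneS_in_S: "oneS \<in> S"
    and star_closed: "\<lbrakk>s \<in> S; t \<in> S\<rbrakk> \<Longrightarrow> s \<star> t \<in> S"
    and ract_closed: "\<lbrakk>s \<in> S; h \<in> carrier H\<rbrakk> \<Longrightarrow> s \<triangleleft> h \<in> S"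
    and lact_closed: "\<lbrakk>s \<in> S; h \<in> carrier H\<rbrakk> \<Longrightarrow> s \<triangleright> h \<in> carrier H"
    and f_closed: "\<lbrakk>s \<in> S; t \<in> S\<rbrakk> \<Longrightarrow> f s t \<in> carrier H"
    and star_oneS: "s \<in> S \<Longrightarrow> s \<star> oneS = s"
    and oneS_star: "s \<in> S \<Longrightarrow> oneS \<star> s = s"
    and ract_one: "s \<in> S \<Longrightarrow> s \<triangleleft> \<one> = s"
    and oneS_ract: "h \<in> carrier H \<Longrightarrow> oneS \<triangleleft> h = oneS"
    and oneS_lact: "h \<in> carrier H \<Longrightarrow> oneS \<triangleright> h = h"
    and lact_one: "s \<in> S \<Longrightarrow> s \<triangleright> \<one> = \<one>"
    and f_oneS_right: "s \<in> S \<Longrightarrow> f s oneS = \<one>"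
    and f_oneS_left: "s \<in> S \<Longrightarrow> f oneS s = \<one>"

definition unified_mult ::
  "('a, 'm) monoid_scheme \<Rightarrow> ('s \<Rightarrow> 's \<Rightarrow> 's) \<Rightarrow> ('s \<Rightarrow> 'a \<Rightarrow> 's) \<Rightarrow> ('s \<Rightarrow> 'a \<Rightarrow> 'a)
    \<Rightarrow> ('s \<Rightarrow> 's \<Rightarrow> 'a) \<Rightarrow> 'a \<times> 's \<Rightarrow> 'a \<times> 's \<Rightarrow> 'a \<times> 's"
  where "unified_mult H star ract lact f =
    (\<lambda>(h\<^sub>1, s\<^sub>1) (h\<^sub>2, s\<^sub>2).
      (h\<^sub>1 \<otimes>\<^bsub>H\<^esub> lact s\<^sub>1 h\<^sub>2 \<otimes>\<^bsub>H\<^esub> f (ract s\<^sub>1 h\<^sub>2) s\<^sub>2,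
       star (ract s\<^sub>1 h\<^sub>2) s\<^sub>2))"

(* The multiplication alone is prescribed, so the unit of the group is existentially
   quantified rather than fixed to be the pair of units. *)
definition is_unified_product ::
  "('a, 'm) monoid_scheme \<Rightarrow> 's set \<Rightarrow> ('s \<Rightarrow> 's \<Rightarrow> 's) \<Rightarrow> ('s \<Rightarrow> 'a \<Rightarrow> 's)
    \<Rightarrow> ('s \<Rightarrow> 'a \<Rightarrow> 'a) \<Rightarrow> ('s \<Rightarrow> 's \<Rightarrow> 'a) \<Rightarrow> bool"
  where "is_unified_product H S star ract lact f \<longleftrightarrow>
    (\<exists>e. group \<lparr>carrier = carrier H \<times> S, mult = unified_mult H star ract lact f, one = e\<rparr>)"

definition right_action ::
  "('a, 'm) monoid_scheme \<Rightarrow> 's set \<Rightarrow> ('s \<Rightarrow> 'a \<Rightarrow> 's) \<Rightarrow> bool"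
  where "right_action H S act \<longleftrightarrow>
    (\<forall>s\<in>S. \<forall>h\<in>carrier H. act s h \<in> S) \<and>
    (\<forall>s\<in>S. act s \<one>\<^bsub>H\<^esub> = s) \<and>
    (\<forall>s\<in>S. \<forall>h\<^sub>1\<in>carrier H. \<forall>h\<^sub>2\<in>carrier H.
       act s (h\<^sub>1 \<otimes>\<^bsub>H\<^esub> h\<^sub>2) = act (act s h\<^sub>1) h\<^sub>2)"

end

theory Submission
  imports Defs
begin

text \<open>
  Write \<open>\<bullet>\<close> for the multiplication of the candidate product. Every element of \<open>H \<times> S\<close> factors
  as \<open>(h, s) = (h, oneS) \<bullet> (\<one>, s)\<close>, so an associative \<open>\<bullet>\<close> is determined by
  how elements \<open>(\<one>, s)\<close> move past elements \<open>(h, oneS)\<close> and past each other: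
  \<open>(\<one>, s) \<bullet> (h, oneS) = (s \<triangleright> h, s \<triangleleft> h)\<close> and \<open>(\<one>, s) \<bullet> (\<one>, t) = (f s t, s \<star> t)\<close>.

  If the product is associative, then comparing the two bracketings of a triple of such elements,
  component by component, gives the compatibilities in pairs: the triple \<open>(\<one>, s), (h, oneS), (k, oneS)\<close>
  gives the action law and the cocycle rule for \<open>\<triangleright>\<close>; \<open>(\<one>, s), (\<one>, t), (h, oneS)\<close> gives the two
  rules for \<open>h\<close> acting on a product; and \<open>(\<one>, s), (\<one>, t), (\<one>, u)\<close> gives the twisted associativity
  of \<open>\<star>\<close> and the cocycle rule for \<open>f\<close>. The pair \<open>(\<one>, oneS)\<close> is neutral for every extending datum,
  so it is the only candidate for the unit, and the second component of a left inverse of \<open>(\<one>, s)\<close>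
  is a left \<open>\<star>\<close>-inverse of \<open>s\<close> (\<open>group_extending_structure_if_group\<close>).

  Conversely, the three pairs of rules suffice to rebracket an arbitrary triple
  (\<open>pair_mult_assoc\<close>), and left \<open>\<star>\<close>-inverses produce left inverses in \<open>H \<times> S\<close>
  (\<open>pair_left_inverse\<close>); a monoid with left inverses is a group.
\<close>

locale group_extending_structure = extending_datum +
  assumes ract_mult:
      "\<lbrakk>s \<in> S; h \<in> carrier H; k \<in> carrier H\<rbrakk> \<Longrightarrow> s \<triangleleft> (h \<otimes> k) = (s \<triangleleft> h) \<triangleleft> k"
    and star_assoc:
      "\<lbrakk>s \<in> S; t \<in> S; u \<in> S\<rbrakk> \<Longrightarrow> (s \<star> t) \<star> u = (s \<triangleleft> f t u) \<star> (t \<star> u)"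
    and lact_mult:
      "\<lbrakk>s \<in> S; h \<in> carrier H; k \<in> carrier H\<rbrakk> \<Longrightarrow>
        s \<triangleright> (h \<otimes> k) = (s \<triangleright> h) \<otimes> ((s \<triangleleft> h) \<triangleright> k)"
    and star_ract:
      "\<lbrakk>s \<in> S; t \<in> S; h \<in> carrier H\<rbrakk> \<Longrightarrow> (s \<star> t) \<triangleleft> h = (s \<triangleleft> (t \<triangleright> h)) \<star> (t \<triangleleft> h)"
    and f_lact:
      "\<lbrakk>s \<in> S; t \<in> S; h \<in> carrier H\<rbrakk> \<Longrightarrow>
        (s \<triangleright> (t \<triangleright> h)) \<otimes> f (s \<triangleleft> (t \<triangleright> h)) (t \<triangleleft> h) = f s t \<otimes> ((s \<star> t) \<triangleright> h)"
    and f_cocycle: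
      "\<lbrakk>s \<in> S; t \<in> S; u \<in> S\<rbrakk> \<Longrightarrow>
        f s t \<otimes> f (s \<star> t) u = (s \<triangleright> f t u) \<otimes> f (s \<triangleleft> f t u) (t \<star> u)"
    and star_left_inverse: "s \<in> S \<Longrightarrow> \<exists>s'\<in>S. s' \<star> s = oneS"

context extending_datum
begin

lemmas datum_closed = oneS_in_S star_closed ract_closed lact_closed f_closed

lemmas datum_units = star_oneS oneS_star ract_one oneS_ract oneS_lact lact_one f_oneS_right f_oneS_left

abbreviation pair_mult :: "'a \<times> 's \<Rightarrow> 'a \<times> 's \<Rightarrow> 'a \<times> 's"  (infixl "\<bullet>" 70)
  where "(\<bullet>) \<equiv> unified_mult H (\<star>) (\<triangleleft>) (\<triangleright>) f"

lemma pair_mult_eq: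
  "(h, s) \<bullet> (k, t) = (h \<otimes> (s \<triangleright> k) \<otimes> f (s \<triangleleft> k) t, (s \<triangleleft> k) \<star> t)"
  by (simp add: unified_mult_def)

lemma pair_mult_closed:
  "\<lbrakk>p \<in> carrier H \<times> S; q \<in> carrier H \<times> S\<rbrakk> \<Longrightarrow> p \<bullet> q \<in> carrier H \<times> S"
  by (auto simp: pair_mult_eq datum_closed)

lemma one_pair_mult: "p \<in> carrier H \<times> S \<Longrightarrow> (\<one>, oneS) \<bullet> p = p"
  by (auto simp: pair_mult_eq datum_closed datum_units)

lemma group_extending_structure_if_group:
  assumes "group \<lparr>carrier = carrier H \<times> S, mult = (\<bullet>), one = e\<rparr>" (is "group ?G")
  shows "group_extending_structure H S oneS (\<star>) (\<triangleleft>) (\<triangleright>) f"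
proof -
  interpret G: group ?G by (fact assms)
  have assoc: "p \<bullet> q \<bullet> r = p \<bullet> (q \<bullet> r)"
    if "p \<in> carrier H \<times> S" "q \<in> carrier H \<times> S" "r \<in> carrier H \<times> S" for p q r
    using G.m_assoc[of p q r] that by simp
  \<comment> \<open>\<open>(\<one>, oneS)\<close> is a left unit and \<open>e\<close> a right unit, so their product equals both.\<close>
  have e: "e = (\<one>, oneS)"
    using G.one_closed G.r_one[of "(\<one>, oneS)"] one_pair_mult[of e] by (simp add: oneS_in_S)
  have SHH: "s \<triangleright> (h \<otimes> k) = (s \<triangleright> h) \<otimes> ((s \<triangleleft> h) \<triangleright> k) \<and> s \<triangleleft> (h \<otimes> k) = (s \<triangleleft> h) \<triangleleft> k"
    if "s \<in> S" "h \<in> carrier H" "k \<in> carrier H" for s h k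
    using assoc[of "(\<one>, s)" "(h, oneS)" "(k, oneS)"] that
    by (simp add: pair_mult_eq datum_closed datum_units)
  have SSH: "(s \<triangleright> (t \<triangleright> h)) \<otimes> f (s \<triangleleft> (t \<triangleright> h)) (t \<triangleleft> h) = f s t \<otimes> ((s \<star> t) \<triangleright> h)
      \<and> (s \<star> t) \<triangleleft> h = (s \<triangleleft> (t \<triangleright> h)) \<star> (t \<triangleleft> h)"
    if "s \<in> S" "t \<in> S" "h \<in> carrier H" for s t h
    using assoc[of "(\<one>, s)" "(\<one>, t)" "(h, oneS)"] that
    by (simp add: pair_mult_eq datum_closed datum_units)
  have SSS: "f s t \<otimes> f (s \<star> t) u = (s \<triangleright> f t u) \<otimes> f (s \<triangleleft> f t u) (t \<star> u)
      \<and> (s \<star> t) \<star> u = (s \<triangleleft> f t u) \<star> (t \<star> u)"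
    if "s \<in> S" "t \<in> S" "u \<in> S" for s t u
    using assoc[of "(\<one>, s)" "(\<one>, t)" "(\<one>, u)"] that
    by (simp add: pair_mult_eq datum_closed datum_units)
  have left_inverse: "\<exists>s'\<in>S. s' \<star> s = oneS" if s: "s \<in> S" for s
  proof -
    obtain h' s' where "s' \<in> S" "(h', s') \<bullet> (\<one>, s) = (\<one>, oneS)"
      using G.l_inv_ex[of "(\<one>, s)"] s e by auto
    then show ?thesis by (auto simp: pair_mult_eq ract_one)
  qed
  show ?thesis
    by unfold_locales
      (fact SHH[THEN conjunct1] SHH[THEN conjunct2] SSH[THEN conjunct1] SSH[THEN conjunct2]
        SSS[THEN conjunct1] SSS[THEN conjunct2] left_inverse)+
qed

end

context group_extending_structure
begin

text \<open>
  With \<open>a = s\<^sub>1 \<triangleleft> h\<^sub>2\<close>, \<open>b = s\<^sub>2 \<triangleleft> h\<^sub>3\<close> and \<open>c = a \<triangleleft> (s\<^sub>2 \<triangleright> h\<^sub>3)\<close>, both bracketings of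
  \<open>(h\<^sub>1, s\<^sub>1), (h\<^sub>2, s\<^sub>2), (h\<^sub>3, s\<^sub>3)\<close> reduce to the same pair once every \<open>S\<close>-element has been moved to
  the right of every \<open>H\<close>-element. On the left, \<open>h\<^sub>3\<close> is first moved past \<open>a \<star> s\<^sub>2\<close>, which leaves
  \<open>(c \<star> b) \<star> s\<^sub>3\<close> to be rebracketed; on the right, \<open>s\<^sub>1\<close> is moved past the product
  \<open>h\<^sub>2 \<otimes> (s\<^sub>2 \<triangleright> h\<^sub>3) \<otimes> f b s\<^sub>3\<close> one factor at a time.
\<close>
lemma pair_mult_assoc:
  assumes "p \<in> carrier H \<times> S" "q \<in> carrier H \<times> S" "r \<in> carrier H \<times> S"
  shows "p \<bullet> q \<bullet> r = p \<bullet> (q \<bullet> r)"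
proof -
  obtain h\<^sub>1 s\<^sub>1 h\<^sub>2 s\<^sub>2 h\<^sub>3 s\<^sub>3 where pqr: "p = (h\<^sub>1, s\<^sub>1)" "q = (h\<^sub>2, s\<^sub>2)" "r = (h\<^sub>3, s\<^sub>3)"
    and [simp]: "h\<^sub>1 \<in> carrier H" "h\<^sub>2 \<in> carrier H" "h\<^sub>3 \<in> carrier H" "s\<^sub>1 \<in> S" "s\<^sub>2 \<in> S" "s\<^sub>3 \<in> S"
    using assms by auto
  note [simp] = datum_closed
  define a where "a = s\<^sub>1 \<triangleleft> h\<^sub>2"
  define b where "b = s\<^sub>2 \<triangleleft> h\<^sub>3"
  define c where "c = a \<triangleleft> (s\<^sub>2 \<triangleright> h\<^sub>3)"
  define g where "g = h\<^sub>2 \<otimes> (s\<^sub>2 \<triangleright> h\<^sub>3) \<otimes> f b s\<^sub>3"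
  have [simp]: "a \<in> S" "b \<in> S" by (simp_all add: a_def b_def)
  have [simp]: "c \<in> S" by (simp add: c_def)
  have ract_g: "s\<^sub>1 \<triangleleft> g = c \<triangleleft> f b s\<^sub>3"
    by (simp add: g_def ract_mult a_def c_def)
  have lact_g: "s\<^sub>1 \<triangleright> g = (s\<^sub>1 \<triangleright> h\<^sub>2) \<otimes> (a \<triangleright> (s\<^sub>2 \<triangleright> h\<^sub>3)) \<otimes> (c \<triangleright> f b s\<^sub>3)"
    by (simp add: g_def ract_mult lact_mult a_def c_def m_assoc)
  have ract_star: "(a \<star> s\<^sub>2) \<triangleleft> h\<^sub>3 = c \<star> b"
    by (simp add: star_ract b_def c_def)
  have "h\<^sub>1 \<otimes> (s\<^sub>1 \<triangleright> h\<^sub>2) \<otimes> f a s\<^sub>2 \<otimes> ((a \<star> s\<^sub>2) \<triangleright> h\<^sub>3) \<otimes> f (c \<star> b) s\<^sub>3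
      = h\<^sub>1 \<otimes> (s\<^sub>1 \<triangleright> h\<^sub>2) \<otimes> (f a s\<^sub>2 \<otimes> ((a \<star> s\<^sub>2) \<triangleright> h\<^sub>3)) \<otimes> f (c \<star> b) s\<^sub>3"
    by (simp add: m_assoc)
  also have "f a s\<^sub>2 \<otimes> ((a \<star> s\<^sub>2) \<triangleright> h\<^sub>3) = (a \<triangleright> (s\<^sub>2 \<triangleright> h\<^sub>3)) \<otimes> f c b"
    by (simp add: f_lact[symmetric] b_def c_def)
  also have "h\<^sub>1 \<otimes> (s\<^sub>1 \<triangleright> h\<^sub>2) \<otimes> ((a \<triangleright> (s\<^sub>2 \<triangleright> h\<^sub>3)) \<otimes> f c b) \<otimes> f (c \<star> b) s\<^sub>3
      = h\<^sub>1 \<otimes> (s\<^sub>1 \<triangleright> h\<^sub>2) \<otimes> (a \<triangleright> (s\<^sub>2 \<triangleright> h\<^sub>3)) \<otimes> (f c b \<otimes> f (c \<star> b) s\<^sub>3)"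
    by (simp add: m_assoc)
  also have "f c b \<otimes> f (c \<star> b) s\<^sub>3 = (c \<triangleright> f b s\<^sub>3) \<otimes> f (c \<triangleleft> f b s\<^sub>3) (b \<star> s\<^sub>3)"
    by (simp add: f_cocycle)
  also have "h\<^sub>1 \<otimes> (s\<^sub>1 \<triangleright> h\<^sub>2) \<otimes> (a \<triangleright> (s\<^sub>2 \<triangleright> h\<^sub>3)) \<otimes>
        ((c \<triangleright> f b s\<^sub>3) \<otimes> f (c \<triangleleft> f b s\<^sub>3) (b \<star> s\<^sub>3))
      = h\<^sub>1 \<otimes> (s\<^sub>1 \<triangleright> g) \<otimes> f (s\<^sub>1 \<triangleleft> g) (b \<star> s\<^sub>3)"
    by (simp add: lact_g ract_g m_assoc)
  finally have "h\<^sub>1 \<otimes> (s\<^sub>1 \<triangleright> h\<^sub>2) \<otimes> f a s\<^sub>2 \<otimes> ((a \<star> s\<^sub>2) \<triangleright> h\<^sub>3) \<otimes> f (c \<star> b) s\<^sub>3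
      = h\<^sub>1 \<otimes> (s\<^sub>1 \<triangleright> g) \<otimes> f (s\<^sub>1 \<triangleleft> g) (b \<star> s\<^sub>3)" .
  moreover have "(c \<star> b) \<star> s\<^sub>3 = (s\<^sub>1 \<triangleleft> g) \<star> (b \<star> s\<^sub>3)"
    by (simp add: star_assoc ract_g)
  moreover have "p \<bullet> q \<bullet> r =
      (h\<^sub>1 \<otimes> (s\<^sub>1 \<triangleright> h\<^sub>2) \<otimes> f a s\<^sub>2 \<otimes> ((a \<star> s\<^sub>2) \<triangleright> h\<^sub>3) \<otimes> f (c \<star> b) s\<^sub>3, (c \<star> b) \<star> s\<^sub>3)"
    by (simp add: pqr pair_mult_eq ract_star flip: a_def)
  moreover have "p \<bullet> (q \<bullet> r) =
      (h\<^sub>1 \<otimes> (s\<^sub>1 \<triangleright> g) \<otimes> f (s\<^sub>1 \<triangleleft> g) (b \<star> s\<^sub>3), (s\<^sub>1 \<triangleleft> g) \<star> (b \<star> s\<^sub>3))"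
    by (simp add: pqr pair_mult_eq g_def flip: b_def)
  ultimately show ?thesis by simp
qed

text \<open>
  In \<open>(k, t) \<bullet> (h, s)\<close> the element \<open>t\<close> reaches \<open>s\<close> only after \<open>h\<close> has acted on it, so a left
  \<open>\<star>\<close>-inverse \<open>s'\<close> of \<open>s\<close> has to be twisted by \<open>inv h\<close> beforehand; \<open>k\<close> then cancels
  the first component.
\<close>
lemma pair_left_inverse:
  assumes "p \<in> carrier H \<times> S"
  shows "\<exists>q \<in> carrier H \<times> S. q \<bullet> p = (\<one>, oneS)"
proof -
  obtain h s where p: "p = (h, s)" and [simp]: "h \<in> carrier H" "s \<in> S"
    using assms by auto
  obtain s' where [simp]: "s' \<in> S" and s': "s' \<star> s = oneS"
    using star_left_inverse[OF \<open>s \<in> S\<close>] by auto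
  define t where "t = s' \<triangleleft> inv h"
  define k where "k = inv ((t \<triangleright> h) \<otimes> f s' s)"
  have [simp]: "t \<in> S" by (simp add: t_def ract_closed)
  have "t \<triangleleft> h = s'" by (simp add: t_def ract_one flip: ract_mult)
  then have "(k, t) \<bullet> p = (\<one>, oneS)"
    by (simp add: p pair_mult_eq s' k_def m_assoc datum_closed)
  moreover have "(k, t) \<in> carrier H \<times> S" by (simp add: k_def datum_closed)
  ultimately show ?thesis by blast
qed

lemma group_pair_mult:
  "group \<lparr>carrier = carrier H \<times> S, mult = (\<bullet>), one = (\<one>, oneS)\<rparr>"
proof (rule groupI, goal_cases)
  case (1 p q)
  then show ?case using pair_mult_closed by simp
next
  case 2
  then show ?case by (simp add: oneS_in_S)
next
  case (3 p q r)
  then show ?case using pair_mult_assoc by simp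
next
  case (4 p)
  then show ?case using one_pair_mult by simp
next
  case (5 p)
  then show ?case using pair_left_inverse by simp
qed

end

theorem theorem2p5:
  fixes H :: "('a, 'm) monoid_scheme" (structure)
    and S :: "'s set"
    and oneS :: 's
    and star :: "'s \<Rightarrow> 's \<Rightarrow> 's"  (infixl "\<star>" 70)
    and ract :: "'s \<Rightarrow> 'a \<Rightarrow> 's"  (infixl "\<triangleleft>" 75)
    and lact :: "'s \<Rightarrow> 'a \<Rightarrow> 'a"  (infixr "\<triangleright>" 75)
    and f :: "'s \<Rightarrow> 's \<Rightarrow> 'a"
  assumes "group H"
    and "extending_datum H S oneS star ract lact f"
  shows "is_unified_product H S star ract lact f \<longleftrightarrow>
     (right_action H S ract \<and>
      (\<forall>s\<^sub>1\<in>S. \<forall>s\<^sub>2\<in>S. \<forall>s\<^sub>3\<in>S.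
         (s\<^sub>1 \<star> s\<^sub>2) \<star> s\<^sub>3 = (s\<^sub>1 \<triangleleft> f s\<^sub>2 s\<^sub>3) \<star> (s\<^sub>2 \<star> s\<^sub>3)) \<and>
      (\<forall>s\<in>S. \<forall>h\<^sub>1\<in>carrier H. \<forall>h\<^sub>2\<in>carrier H.
         s \<triangleright> (h\<^sub>1 \<otimes> h\<^sub>2) = (s \<triangleright> h\<^sub>1) \<otimes> ((s \<triangleleft> h\<^sub>1) \<triangleright> h\<^sub>2)) \<and>
      (\<forall>s\<^sub>1\<in>S. \<forall>s\<^sub>2\<in>S. \<forall>h\<in>carrier H.
         (s\<^sub>1 \<star> s\<^sub>2) \<triangleleft> h = (s\<^sub>1 \<triangleleft> (s\<^sub>2 \<triangleright> h)) \<star> (s\<^sub>2 \<triangleleft> h)) \<and>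
      (\<forall>s\<^sub>1\<in>S. \<forall>s\<^sub>2\<in>S. \<forall>h\<in>carrier H.
         (s\<^sub>1 \<triangleright> (s\<^sub>2 \<triangleright> h)) \<otimes> f (s\<^sub>1 \<triangleleft> (s\<^sub>2 \<triangleright> h)) (s\<^sub>2 \<triangleleft> h)
           = f s\<^sub>1 s\<^sub>2 \<otimes> ((s\<^sub>1 \<star> s\<^sub>2) \<triangleright> h)) \<and>
      (\<forall>s\<^sub>1\<in>S. \<forall>s\<^sub>2\<in>S. \<forall>s\<^sub>3\<in>S.
         f s\<^sub>1 s\<^sub>2 \<otimes> f (s\<^sub>1 \<star> s\<^sub>2) s\<^sub>3
           = (s\<^sub>1 \<triangleright> f s\<^sub>2 s\<^sub>3) \<otimes> f (s\<^sub>1 \<triangleleft> f s\<^sub>2 s\<^sub>3) (s\<^sub>2 \<star> s\<^sub>3)) \<and>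
      (\<forall>s\<in>S. \<exists>s'\<in>S. s' \<star> s = oneS))"
proof -
  interpret extending_datum H S oneS star ract lact f by (fact assms(2))
  have "is_unified_product H S (\<star>) (\<triangleleft>) (\<triangleright>) f
      \<longleftrightarrow> group_extending_structure H S oneS (\<star>) (\<triangleleft>) (\<triangleright>) f"
    unfolding is_unified_product_def
    by (rule iffI, elim exE, erule group_extending_structure_if_group,
        rule exI, erule group_extending_structure.group_pair_mult)
  also have "\<dots> \<longleftrightarrow> group_extending_structure_axioms H S oneS (\<star>) (\<triangleleft>) (\<triangleright>) f"
    using assms(2) by (simp add: group_extending_structure_def)
  finally show ?thesis
    by (simp add: group_extending_structure_axioms_def right_action_def Ball_def
        ract_closed ract_one)
qed

end
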